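(* Let $r\ge 1$ and $n\ge 2$ be integers. For every integer $t$ with $0\le t\le n^r$, $$b(t)=N_r\bigl(2^r-N^*(t)\bigr).$$
   Context: $[n]^r$ denotes the complete $r$-partite $r$-uniform hypergraph with pairwise disjoint sides $V_1,\dots,V_r$, each of size $n$: its edges are the sets containing exactly one vertex from each $V_i$ (so it has $n^r$ edges). For a set $F$ of edges of $[n]^r$, the blocker $B(F)$ is the set of edges of $[n]^r$ that meet (have non-empty intersection with) every edge of $F$. For an integer $0\le t\le n^r$, $b(t)$ is the maximum of $|B(F)|$ over all sets $F$ of exactly $t$ edges of $[n]^r$. Fix one vertex $v_i\in V_i$ for each $i$. Let $\Psi_r$ be the set of (possibly empty) sequences of length at most $r-1$ consisting of symbols $\wedge$ and $\vee$, and let $\Sigma_r=\Psi_r\cup\{\alpha,\omega\}$, where $\alpha,\omega$ are two new elements; $|\Sigma_r|=2^r+1$. Put $F_r(\alpha)=\emptyset$, $F_r(\omega)=[n]^r$, and for $\sigma=(\sigma_1,\dots,\sigma_m)\in\Psi_r$ let $$F_r(\sigma)=\{e\in[n]^r \mid v_1\in e\ \sigma_1\,(v_2\in e\ \sigma_2\,(v_3\in e\ \cdots\ \sigma_m\,(v_{m+1}\in e)\cdots))\},$$ where $\wedge$ is logical "and" and $\vee$ is logical "or" (for $\sigma$ empty, $F_r(\sigma)=\{e\mid v_1\in e\}$). Let $f_r(\sigma)=|F_r(\sigma)|$. For $n\ge2$ the $2^r+1$ numbers $f_r(\sigma)$, $\sigma\in\Sigma_r$, are pairwise distinct; listing them in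 increasing order, $N_r(i)$ denotes the $i$-th one, $0\le i\le 2^r$, so that $0=N_r(0)<N_r(1)<\dots<N_r(2^r)=n^r$. For an integer $0\le t\le n^r$, $N^*(t)$ is the index $q\in\{0,\dots,2^r\}$ with $N_r(q-1)<t\le N_r(q)$, with the convention $N_r(-1)=-\infty$ (so $N^*(0)=0$). *)

theory Defs
  imports Main "HOL-Library.Disjoint_Sets"
begin

text \<open>The sides are \<open>V 1, \<dots>, V r\<close>; values of \<open>V\<close> and \<open>v\<close> at other indices are irrelevant.
  The common size \<open>n\<close> of the sides enters only through \<open>V\<close>.\<close>

definition complete_edges :: "nat \<Rightarrow> (nat \<Rightarrow> 'a set) \<Rightarrow> 'a set set" where
  "complete_edges r V =
    {e. e \<subseteq> (\<Union>i\<in>{1..r}. V i) \<and> (\<forall>i\<in>{1..r}. \<exists>!x. x \<in> e \<and> x \<in> V i)}"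

definition blocker :: "nat \<Rightarrow> (nat \<Rightarrow> 'a set) \<Rightarrow> 'a set set \<Rightarrow> 'a set set" where
  "blocker r V F = {e \<in> complete_edges r V. \<forall>f\<in>F. e \<inter> f \<noteq> {}}"

definition max_blocker :: "nat \<Rightarrow> (nat \<Rightarrow> 'a set) \<Rightarrow> nat \<Rightarrow> nat" where
  "max_blocker r V t =
    Max {card (blocker r V F) | F. F \<subseteq> complete_edges r V \<and> card F = t}"

datatype connective = Wedge | Vee

datatype symb = Alpha | Omega | Conn "connective list"

definition Psi :: "nat \<Rightarrow> connective list set" where
  "Psi r = {s. length s \<le> r - 1}"

definition Sigma_r :: "nat \<Rightarrow> symb set" where
  "Sigma_r r = {Alpha, Omega} \<union> Conn ` Psi r"

text \<open>\<open>conn_holds v e i [\<sigma>\<^sub>1, \<dots>, \<sigma>\<^sub>m]\<close> is the right-nested formula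
  \<open>v i \<in> e \<sigma>\<^sub>1 (v (i + 1) \<in> e \<sigma>\<^sub>2 (\<dots> \<sigma>\<^sub>m (v (i + m) \<in> e)\<dots>))\<close>.\<close>

fun conn_holds :: "(nat \<Rightarrow> 'a) \<Rightarrow> 'a set \<Rightarrow> nat \<Rightarrow> connective list \<Rightarrow> bool" where
  "conn_holds v e i [] \<longleftrightarrow> v i \<in> e"
| "conn_holds v e i (Wedge # s) \<longleftrightarrow> v i \<in> e \<and> conn_holds v e (Suc i) s"
| "conn_holds v e i (Vee # s) \<longleftrightarrow> v i \<in> e \<or> conn_holds v e (Suc i) s"

fun F_fam :: "nat \<Rightarrow> (nat \<Rightarrow> 'a set) \<Rightarrow> (nat \<Rightarrow> 'a) \<Rightarrow> symb \<Rightarrow> 'a set set" where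
  "F_fam r V v Alpha = {}"
| "F_fam r V v Omega = complete_edges r V"
| "F_fam r V v (Conn s) = {e \<in> complete_edges r V. conn_holds v e 1 s}"

definition f_card :: "nat \<Rightarrow> (nat \<Rightarrow> 'a set) \<Rightarrow> (nat \<Rightarrow> 'a) \<Rightarrow> symb \<Rightarrow> nat" where
  "f_card r V v \<sigma> = card (F_fam r V v \<sigma>)"

text \<open>For sides of size \<open>n \<ge> 2\<close> the values of \<open>f_card r V v\<close> on \<open>Sigma_r r\<close> are pairwise distinct,
  so the list below has length \<open>2 ^ r + 1\<close> and its valid indices are \<open>0, \<dots>, 2 ^ r\<close>.\<close>

definition N_list :: "nat \<Rightarrow> (nat \<Rightarrow> 'a set) \<Rightarrow> (nat \<Rightarrow> 'a) \<Rightarrow> nat \<Rightarrow> nat" where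
  "N_list r V v i = sorted_list_of_set (f_card r V v ` Sigma_r r) ! i"

text \<open>The disjunct \<open>q = 0\<close> encodes the convention that the value at index \<open>-1\<close> is \<open>-\<infinity>\<close>.\<close>

definition N_star :: "nat \<Rightarrow> (nat \<Rightarrow> 'a set) \<Rightarrow> (nat \<Rightarrow> 'a) \<Rightarrow> nat \<Rightarrow> nat" where
  "N_star r V v t =
    (THE q. q \<le> 2 ^ r \<and> (q = 0 \<or> N_list r V v (q - 1) < t) \<and> t \<le> N_list r V v q)"

end

theory Submission
  imports Defs "HOL-Library.FuncSet"
begin

text \<open>
  Write \<open>q = n - 1\<close> and let \<open>g k\<close> be the sum, over \<open>i < k\<close>, of \<open>q\<close> to the number of ones in the
  binary expansion of \<open>i\<close>. Everything rests on the fact that the sizes \<open>f\<^sub>r(\<sigma>)\<close>, in increasing order,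
  are \<open>g 0, g 1, \<dots>, g (2 ^ r)\<close>: deciding the formula one coordinate at a time, a leading \<open>\<and>\<close>
  leaves a formula in one variable less on the single vertex \<open>v\<^sub>1\<close>, while a leading \<open>\<or>\<close> takes all
  \<open>n ^ (r - 1)\<close> edges at \<open>v\<^sub>1\<close> and \<open>q\<close> copies of the remaining family. This matches
  \<open>g (2 ^ m + i) = n ^ m + q * g i\<close> (lemmas \<open>card_conn_holds\<close>, \<open>N_list_eq\<close>). Thus \<open>N\<^sup>*(t)\<close> is the
  least \<open>k\<close> with \<open>t \<le> g k\<close>, called the rank of \<open>t\<close>.

  For the lower bound, exchanging \<open>\<and>\<close> and \<open>\<or>\<close> turns the formula of index \<open>k\<close> into the one of index
  \<open>2 ^ r - k\<close>, and every edge satisfying a formula meets every edge satisfying its dual. So any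
  \<open>t\<close> edges chosen inside the family of index \<open>k = N\<^sup>*(t)\<close> are blocked by a family of size
  \<open>g (2 ^ r - k)\<close>.

  For the upper bound it suffices that the ranks of the sizes of two cross-intersecting families
  \<open>F\<close>, \<open>G\<close> add up to at most \<open>2 ^ r\<close> (lemma \<open>cross_intersecting_rank_le\<close>). Slice both families by
  the vertex used in one side. Slices of \<open>F\<close> and \<open>G\<close> at different vertices cross-intersect in the
  other sides, so their ranks add up to at most \<open>2 ^ (r - 1)\<close>. The inequality
  \<open>g a + q * g b \<le> g (a + b)\<close> for \<open>b \<le> a\<close> (lemma \<open>binary_weight_superadditive\<close>) shows that the
  rank of \<open>|F|\<close> is at most the sum of the two largest ranks of its slices, say at \<open>a \<noteq> a'\<close>, and
  likewise for \<open>G\<close> at \<open>b \<noteq> b'\<close>. One of the two ways of pairing \<open>a, a'\<close> with \<open>b, b'\<close> pairs only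
  different vertices, which bounds the four ranks together by \<open>2 * 2 ^ (r - 1)\<close>.
\<close>

section \<open>The binary weight\<close>

text \<open>The sum, over \<open>i < k\<close>, of \<open>q\<close> to the number of ones in the binary expansion of \<open>i\<close>. The recursion
  separates the even \<open>i\<close> from the odd ones, whose last digit contributes the factor \<open>q\<close>.\<close>

fun binary_weight :: "nat \<Rightarrow> nat \<Rightarrow> nat" where
  "binary_weight q k =
    (if k \<le> 1 then k else binary_weight q (Suc k div 2) + q * binary_weight q (k div 2))"

declare binary_weight.simps [simp del]

lemma binary_weight_0 [simp]: "binary_weight q 0 = 0"
  and binary_weight_1 [simp]: "binary_weight q (Suc 0) = 1"
  by (simp_all add: binary_weight.simps)

lemma binary_weight_even: "binary_weight q (2 * k) = (1 + q) * binary_weight q k"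
proof (cases "k = 0")
  case False
  then show ?thesis by (subst binary_weight.simps) simp
qed simp

lemma binary_weight_odd:
  "binary_weight q (Suc (2 * k)) = binary_weight q (Suc k) + q * binary_weight q k"
proof (cases "k = 0")
  case False
  then show ?thesis by (subst binary_weight.simps) simp
qed simp

lemma binary_weight_even_Suc:
  "binary_weight q (Suc (Suc (2 * k))) = (1 + q) * binary_weight q (Suc k)"
  using binary_weight_even[of q "Suc k"] by simp

lemma binary_weight_less_Suc:
  assumes "q \<ge> 1"
  shows "binary_weight q k < binary_weight q (Suc k)"
proof (induction k rule: less_induct)
  case (less k)
  show ?case
  proof (cases "k = 0")
    case False
    show ?thesis
    proof (cases "even k")
      case True
      then obtain m where m: "k = 2 * m" by (elim evenE)
      with less[of m] False show ?thesis
        by (simp add: binary_weight_even binary_weight_odd)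
    next
      case odd: False
      then obtain m where m: "k = Suc (2 * m)" by (elim oddE) simp
      from less[of m] m assms show ?thesis
        by (simp add: binary_weight_even_Suc binary_weight_odd)
    qed
  qed simp
qed

lemma strict_mono_binary_weight: "q \<ge> 1 \<Longrightarrow> strict_mono (binary_weight q)"
  by (simp add: strict_mono_Suc_iff binary_weight_less_Suc)

lemma binary_weight_le_iff: "q \<ge> 1 \<Longrightarrow> binary_weight q k \<le> binary_weight q l \<longleftrightarrow> k \<le> l"
  by (simp add: strict_mono_less_eq strict_mono_binary_weight)

text \<open>The increment at \<open>k\<close> is \<open>q\<close> to the number of ones of \<open>k\<close>, and passing from \<open>k\<close> to \<open>k + 1\<close> creates
  at most one new one; hence the next increment is at most \<open>q\<close> times larger. The inequality is
  written without subtraction.\<close>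

lemma binary_weight_increment_le:
  assumes "q \<ge> 1"
  shows "binary_weight q (Suc (Suc k)) + q * binary_weight q k \<le> (1 + q) * binary_weight q (Suc k)"
proof (induction k rule: less_induct)
  case (less k)
  show ?case
  proof (cases "even k")
    case True
    then obtain m where m: "k = 2 * m" by (elim evenE)
    show ?thesis unfolding m binary_weight_even_Suc binary_weight_odd binary_weight_even
      by (simp add: algebra_simps)
  next
    case False
    then obtain m where m: "k = Suc (2 * m)" by (elim oddE) simp
    define x y z where "x = binary_weight q m" and "y = binary_weight q (Suc m)"
      and "z = binary_weight q (Suc (Suc m))"
    have IH: "z + q * x \<le> (1 + q) * y" using less[of m] m by (simp add: x_def y_def z_def)
    obtain p where p: "q = Suc p" using assms by (cases q) auto
    have "x \<le> y" using binary_weight_less_Suc[OF assms, of m] by (simp add: x_def y_def)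
    then have "q * p * x \<le> q * p * y" by simp
    with IH have "z + q * y + q * (y + q * x) \<le> (1 + q) * ((1 + q) * y)"
      unfolding p by (simp add: algebra_simps)
    moreover have "binary_weight q (Suc (Suc k)) = z + q * y"
      using binary_weight_odd[of q "Suc m"] by (simp add: m y_def z_def)
    ultimately show ?thesis
      using binary_weight_odd[of q m] binary_weight_even_Suc[of q m] by (simp add: m x_def y_def)
  qed
qed

text \<open>Halving \<open>a\<close> and \<open>b\<close> splits both sides into a contribution of even and one of odd numbers, each an
  instance of the claim for roughly half the arguments. Let \<open>c\<close>, \<open>d\<close> be the rounded-down halves.
  If \<open>a\<close> and \<open>b\<close> are both odd, the halves of
  the left side add up to \<open>c + d + 2\<close> and \<open>c + d\<close> where the right side has \<open>c + d + 1\<close> twice; the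
  bound on increments levels this out.\<close>

lemma binary_weight_superadditive:
  assumes "q \<ge> 1" and "b \<le> a"
  shows "binary_weight q a + q * binary_weight q b \<le> binary_weight q (a + b)"
  using assms(2)
proof (induction "a + b" arbitrary: a b rule: less_induct)
  case less
  let ?g = "binary_weight q"
  have IH: "?g a' + q * ?g b' \<le> ?g (a' + b')" if "a' + b' < a + b" "b' \<le> a'" for a' b'
    using less that by blast
  \<comment> \<open>At \<open>a = b = 1\<close> halving reproduces the same instance, so this case is checked directly.\<close>
  consider "b = 0" | "a = 1" "b = 1" | "b > 0" "a + b > 2" using less.prems by linarith
  then show ?case
  proof cases
    case 2
    then show ?thesis using binary_weight_even[of q 1] by (simp add: numeral_2_eq_2)
  next
    case 3
    obtain c where c: "a = 2 * c \<or> a = Suc (2 * c)" by (metis oddE evenE Suc_eq_plus1)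
    obtain d where d: "b = 2 * d \<or> b = Suc (2 * d)" by (metis oddE evenE Suc_eq_plus1)
    have dc: "d \<le> c" using c d less.prems by auto
    have IH0: "?g c + q * ?g d \<le> ?g (c + d)" using IH[of c d] c d dc 3 by auto
    consider "a = 2 * c" "b = 2 * d" | "a = Suc (2 * c)" "b = 2 * d"
      | "a = 2 * c" "b = Suc (2 * d)" | "a = Suc (2 * c)" "b = Suc (2 * d)"
      using c d by blast
    then show ?thesis
    proof cases
      case 1
      have "?g (a + b) = (1 + q) * ?g (c + d)" using 1 binary_weight_even[of q "c + d"] by simp
      moreover have "?g a + q * ?g b = (1 + q) * (?g c + q * ?g d)"
        unfolding 1 binary_weight_even by (simp add: algebra_simps)
      ultimately show ?thesis using IH0 by (metis mult_le_mono2)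
    next
      case e: 2
      have "?g (a + b) = ?g (Suc (c + d)) + q * ?g (c + d)"
        using e binary_weight_odd[of q "c + d"] by simp
      moreover have "?g a + q * ?g b = (?g (Suc c) + q * ?g d) + q * (?g c + q * ?g d)"
        unfolding e binary_weight_even binary_weight_odd by (simp add: algebra_simps)
      moreover have "?g (Suc c) + q * ?g d \<le> ?g (Suc (c + d))"
        using IH[of "Suc c" d] e dc 3 by simp
      ultimately show ?thesis using mult_le_mono2[OF IH0, of q] by linarith
    next
      case e: 3
      have "?g (a + b) = ?g (Suc (c + d)) + q * ?g (c + d)"
        using e binary_weight_odd[of q "c + d"] by simp
      moreover have "?g a + q * ?g b = (?g c + q * ?g (Suc d)) + q * (?g c + q * ?g d)"
        unfolding e binary_weight_even binary_weight_odd by (simp add: algebra_simps)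
      moreover have "?g c + q * ?g (Suc d) \<le> ?g (Suc (c + d))"
        using IH[of c "Suc d"] e less.prems by simp
      ultimately show ?thesis using mult_le_mono2[OF IH0, of q] by linarith
    next
      case e: 4
      have "?g (a + b) = (1 + q) * ?g (Suc (c + d))"
        using e binary_weight_even_Suc[of q "c + d"] by simp
      moreover have "?g a + q * ?g b = (?g (Suc c) + q * ?g (Suc d)) + q * (?g c + q * ?g d)"
        unfolding e binary_weight_odd by (simp add: algebra_simps)
      moreover have "?g (Suc c) + q * ?g (Suc d) \<le> ?g (Suc (Suc (c + d)))"
        using IH[of "Suc c" "Suc d"] e dc 3 by simp
      ultimately show ?thesis
        using mult_le_mono2[OF IH0, of q] binary_weight_increment_le[OF assms(1), of "c + d"]
        by linarith
    qed
  qed simp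
qed

text \<open>The numbers below \<open>2 ^ m\<close> have \<open>m\<close> free digits, hence total weight \<open>(1 + q) ^ m\<close>. The others are
  \<open>2 ^ m + j\<close> with \<open>j < i\<close>; for \<open>j < 2 ^ m\<close> such a number has one digit one more than \<open>j\<close>.\<close>

lemma binary_weight_power2_add:
  "i \<le> 2 ^ m \<Longrightarrow> binary_weight q (2 ^ m + i) = (1 + q) ^ m + q * binary_weight q i"
proof (induction m arbitrary: i)
  case 0
  then have "i = 0 \<or> i = 1" by auto
  then show ?case using binary_weight_even[of q 1] by (auto simp: numeral_2_eq_2)
next
  case (Suc m)
  show ?case
  proof (cases "even i")
    case True
    then obtain j where j: "i = 2 * j" by (elim evenE)
    then have "2 ^ Suc m + i = 2 * (2 ^ m + j)" by simp
    moreover have "j \<le> 2 ^ m" using Suc.prems j by simp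
    ultimately show ?thesis unfolding j
      by (simp only: binary_weight_even Suc.IH) (simp add: algebra_simps)
  next
    case False
    then obtain j where j: "i = Suc (2 * j)" by (elim oddE) simp
    then have "2 ^ Suc m + i = Suc (2 * (2 ^ m + j))" by simp
    moreover have "Suc j \<le> 2 ^ m" using Suc.prems j by simp
    moreover have "Suc (2 ^ m + j) = 2 ^ m + Suc j" by simp
    ultimately show ?thesis unfolding j
      by (simp only: binary_weight_odd Suc.IH Suc_leD) (simp add: algebra_simps)
  qed
qed

lemma binary_weight_power2: "binary_weight q (2 ^ m) = (1 + q) ^ m"
  using binary_weight_power2_add[of 0 m q] by simp

section \<open>The rank of a size\<close>

text \<open>Meant for \<open>q \<ge> 1\<close>, where it is the lower adjoint of \<open>binary_weight q\<close> (lemma \<open>rank_le_iff\<close>).\<close>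

definition rank :: "nat \<Rightarrow> nat \<Rightarrow> nat" where
  "rank q t = (LEAST k. t \<le> binary_weight q k)"

lemma rank_le_iff:
  assumes "q \<ge> 1"
  shows "rank q t \<le> k \<longleftrightarrow> t \<le> binary_weight q k"
proof
  have "t \<le> binary_weight q t"
    by (rule strict_mono_imp_increasing[OF strict_mono_binary_weight[OF assms]])
  then have "t \<le> binary_weight q (rank q t)"
    unfolding rank_def by (rule LeastI)
  also assume "rank q t \<le> k"
  then have "binary_weight q (rank q t) \<le> binary_weight q k"
    by (simp only: binary_weight_le_iff[OF assms])
  finally show "t \<le> binary_weight q k" .
qed (simp add: rank_def Least_le)

text \<open>Let \<open>a\<close> maximise the rank of \<open>c\<close> on \<open>A\<close>, and \<open>a'\<close> on the remaining \<open>q\<close> elements. The sum is then at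
  most one weight of the largest rank plus \<open>q\<close> weights of the second largest, which is exactly what
  superadditivity absorbs into the weight of the sum of the two ranks.\<close>

lemma rank_sum_le:
  assumes "q \<ge> 1" and "card A = Suc q"
  obtains a a' where "a \<in> A" "a' \<in> A" "a \<noteq> a'"
    "rank q (\<Sum>x\<in>A. c x) \<le> rank q (c a) + rank q (c a')"
proof -
  have fin: "finite A" and ne: "A \<noteq> {}" using assms by (auto intro: card_ge_0_finite)
  obtain a where a: "a \<in> A" "\<And>x. x \<in> A \<Longrightarrow> rank q (c x) \<le> rank q (c a)"
    using obtains_MAX[OF fin ne, of "\<lambda>x. rank q (c x)"] Max_ge[of "(\<lambda>x. rank q (c x)) ` A"] fin
    by (metis finite_imageI imageI)
  have card': "card (A - {a}) = q" using a assms by simp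
  have fin': "finite (A - {a})" and ne': "A - {a} \<noteq> {}"
    using fin card' assms(1) by (simp, metis card.empty not_one_le_zero)
  obtain a' where a': "a' \<in> A - {a}" "\<And>x. x \<in> A - {a} \<Longrightarrow> rank q (c x) \<le> rank q (c a')"
    using obtains_MAX[OF fin' ne', of "\<lambda>x. rank q (c x)"]
      Max_ge[of "(\<lambda>x. rank q (c x)) ` (A - {a})"] fin'
    by (metis finite_imageI imageI)
  have "(\<Sum>x\<in>A. c x) = c a + (\<Sum>x\<in>A - {a}. c x)"
    by (rule sum.remove[OF fin a(1)])
  also have "\<dots> \<le> binary_weight q (rank q (c a)) + q * binary_weight q (rank q (c a'))"
    using sum_bounded_above[of "A - {a}" c "binary_weight q (rank q (c a'))"] a'(2) card'
    by (intro add_mono) (simp_all add: rank_le_iff[OF assms(1), symmetric])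
  also have "\<dots> \<le> binary_weight q (rank q (c a) + rank q (c a'))"
    using a(2) a'(1) by (intro binary_weight_superadditive[OF assms(1)]) auto
  finally have "rank q (\<Sum>x\<in>A. c x) \<le> rank q (c a) + rank q (c a')"
    by (simp only: rank_le_iff[OF assms(1)])
  then show thesis using a(1) a'(1) by (intro that[of a a']) auto
qed

section \<open>Cross-intersecting families of functions\<close>

lemma card_PiE_slices:
  assumes "finite I" "i \<notin> I" "\<And>j. j \<in> insert i I \<Longrightarrow> finite (V j)"
    and "F \<subseteq> PiE (insert i I) V"
  shows "card F = (\<Sum>x\<in>V i. card {\<psi> \<in> PiE I V. \<psi>(i := x) \<in> F})"
proof -
  let ?S = "SIGMA x:V i. {\<psi> \<in> PiE I V. \<psi>(i := x) \<in> F}"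
  have img: "(\<lambda>(x, \<psi>). \<psi>(i := x)) ` ?S = F"
  proof
    show "F \<subseteq> (\<lambda>(x, \<psi>). \<psi>(i := x)) ` ?S"
    proof
      fix \<phi> assume "\<phi> \<in> F"
      with assms(4) have "\<phi> \<in> (\<lambda>(x, \<psi>). \<psi>(i := x)) ` (V i \<times> PiE I V)"
        unfolding PiE_insert_eq by (rule subsetD)
      then obtain p where "p \<in> V i \<times> PiE I V" "\<phi> = (\<lambda>(x, \<psi>). \<psi>(i := x)) p" by (rule imageE)
      with \<open>\<phi> \<in> F\<close> show "\<phi> \<in> (\<lambda>(x, \<psi>). \<psi>(i := x)) ` ?S"
        by (cases p, intro image_eqI[of _ _ p]) simp_all
    qed
  qed (simp add: image_subset_iff)
  have "inj_on (\<lambda>(x, \<psi>). \<psi>(i := x)) ?S"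
    by (rule inj_on_subset[OF inj_combinator[OF assms(2), of V]]) (rule Sigma_mono, simp_all)
  from card_image[OF this] have "card F = card ?S" unfolding img .
  also have "\<dots> = (\<Sum>x\<in>V i. card {\<psi> \<in> PiE I V. \<psi>(i := x) \<in> F})"
  proof (rule card_SigmaI)
    have "finite (PiE I V)" using assms(3) by (intro finite_PiE[OF assms(1)]) simp
    then show "\<forall>x\<in>V i. finite {\<psi> \<in> PiE I V. \<psi>(i := x) \<in> F}" by simp
  qed (simp add: assms(3))
  finally show ?thesis .
qed

text \<open>Induction on the coordinates. Only slices at different values of the new coordinate are sure to
  cross-intersect in the old ones, and these suffice: the size of each family is controlled by two
  of its slices, and two distinct values for \<open>F\<close> can be matched with two distinct values for \<open>G\<close> so
  that matched values differ.\<close>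

lemma cross_intersecting_rank_le:
  assumes "q \<ge> 1" and "finite I" and "\<And>i. i \<in> I \<Longrightarrow> card (V i) = Suc q"
    and "F \<subseteq> PiE I V" "G \<subseteq> PiE I V"
    and "\<And>\<phi> \<psi>. \<phi> \<in> F \<Longrightarrow> \<psi> \<in> G \<Longrightarrow> \<exists>i\<in>I. \<phi> i = \<psi> i"
  shows "rank q (card F) + rank q (card G) \<le> 2 ^ card I"
  using assms(2-)
proof (induction I arbitrary: F G rule: finite_induct)
  case empty
  have "F \<subseteq> {\<lambda>_. undefined}" "G \<subseteq> {\<lambda>_. undefined}"
    using empty.prems(2,3) by (simp_all add: PiE_empty_domain)
  then have FG: "F = {} \<or> F = {\<lambda>_. undefined}" "G = {} \<or> G = {\<lambda>_. undefined}" by blast+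
  with empty.prems(4) have "F = {} \<or> G = {}" by blast
  moreover have "rank q 0 = 0" using rank_le_iff[OF assms(1), of 0 0] by simp
  moreover have "rank q (card F) \<le> 1" "rank q (card G) \<le> 1"
    using FG by (auto simp: rank_le_iff[OF assms(1)])
  ultimately show ?case by (elim disjE) simp_all
next
  case (insert i I)
  have fin: "\<And>j. j \<in> insert i I \<Longrightarrow> finite (V j)"
    using insert.prems(1) by (metis card.infinite nat.distinct(1))
  define sl where "sl H x = {\<psi> \<in> PiE I V. \<psi>(i := x) \<in> H}" for H x
  have card_sl: "card H = (\<Sum>x\<in>V i. card (sl H x))" if "H \<subseteq> PiE (insert i I) V" for H
    unfolding sl_def by (rule card_PiE_slices[OF insert.hyps fin that])
  have cross: "rank q (card (sl F x)) + rank q (card (sl G y)) \<le> 2 ^ card I" if "x \<noteq> y" for x y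
  proof (rule insert.IH)
    fix \<phi> \<psi> assume "\<phi> \<in> sl F x" "\<psi> \<in> sl G y"
    then have "\<phi>(i := x) \<in> F" "\<psi>(i := y) \<in> G" by (simp_all add: sl_def)
    from insert.prems(4)[OF this]
    have "\<exists>j\<in>insert i I. (\<phi>(i := x)) j = (\<psi>(i := y)) j" .
    with that show "\<exists>j\<in>I. \<phi> j = \<psi> j" by (auto split: if_splits)
  qed (use insert.prems(1) in \<open>auto simp: sl_def\<close>)
  have card_Vi: "card (V i) = Suc q" using insert.prems(1) by simp
  obtain a a' where a: "a \<noteq> a'"
    "rank q (card F) \<le> rank q (card (sl F a)) + rank q (card (sl F a'))"
    unfolding card_sl[OF insert.prems(2)] by (rule rank_sum_le[OF assms(1) card_Vi])
  obtain b b' where b: "b \<noteq> b'"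
    "rank q (card G) \<le> rank q (card (sl G b)) + rank q (card (sl G b'))"
    unfolding card_sl[OF insert.prems(3)] by (rule rank_sum_le[OF assms(1) card_Vi])
  have "(a \<noteq> b \<and> a' \<noteq> b') \<or> (a \<noteq> b' \<and> a' \<noteq> b)" using a(1) b(1) by auto
  then have "rank q (card F) + rank q (card G) \<le> 2 * 2 ^ card I"
    using cross[of a b] cross[of a' b'] cross[of a b'] cross[of a' b] a(2) b(2) by linarith
  then show ?case using insert.hyps by simp
qed

section \<open>Sizes of the families given by formulas\<close>

text \<open>The position, counted from 1, of a formula in \<open>d\<close> variables among all such formulas, ordered by the size of the
  families that they define; lemma \<open>card_conn_holds\<close> justifies the name.\<close>

fun conn_index :: "nat \<Rightarrow> connective list \<Rightarrow> nat" where
  "conn_index d [] = 2 ^ (d - 1)"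
| "conn_index d (Wedge # s) = conn_index (d - 1) s"
| "conn_index d (Vee # s) = 2 ^ (d - 1) + conn_index (d - 1) s"

lemma conn_index_le: "length s < d \<Longrightarrow> conn_index d s \<le> 2 ^ d"
proof (induction d s rule: conn_index.induct)
  case (1 d)
  then show ?case by (simp add: power_increasing)
next
  case (2 d s)
  then have "conn_index (d - 1) s \<le> 2 ^ (d - 1)" by simp
  also have "\<dots> \<le> 2 ^ d" by (simp add: power_increasing)
  finally show ?case by simp
next
  case (3 d s)
  then have "conn_index (d - 1) s \<le> 2 ^ (d - 1)" by simp
  then show ?case using 3 by (cases d) auto
qed

lemma conn_index_surj:
  "0 < k \<Longrightarrow> k < 2 ^ d \<Longrightarrow> \<exists>s. length s < d \<and> conn_index d s = k"
proof (induction d arbitrary: k)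
  case (Suc d)
  show ?case
  proof (cases k "2 ^ d :: nat" rule: linorder_cases)
    case less
    then obtain s where "length s < d" "conn_index d s = k" using Suc by blast
    then show ?thesis by (intro exI[of _ "Wedge # s"]) simp
  next
    case equal
    then show ?thesis by (intro exI[of _ "[]"]) simp
  next
    case greater
    then have "0 < k - 2 ^ d" "k - 2 ^ d < 2 ^ d" using Suc.prems by auto
    then obtain s where "length s < d" "conn_index d s = k - 2 ^ d" using Suc.IH by blast
    then show ?thesis using greater by (intro exI[of _ "Vee # s"]) simp
  qed
qed simp

fun dual_conn :: "connective \<Rightarrow> connective" where
  "dual_conn Wedge = Vee"
| "dual_conn Vee = Wedge"

fun dual_symb :: "symb \<Rightarrow> symb" where
  "dual_symb Alpha = Omega"
| "dual_symb Omega = Alpha"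
| "dual_symb (Conn s) = Conn (map dual_conn s)"

lemma conn_index_dual:
  "length s < d \<Longrightarrow> conn_index d s + conn_index d (map dual_conn s) = 2 ^ d"
proof (induction d s rule: conn_index.induct)
  case (1 d)
  then show ?case by (cases d) auto
next
  case (2 d s)
  then have "conn_index (d - 1) s + conn_index (d - 1) (map dual_conn s) = 2 ^ (d - 1)" by simp
  then show ?case using 2 by (cases d) auto
next
  case (3 d s)
  then have "conn_index (d - 1) s + conn_index (d - 1) (map dual_conn s) = 2 ^ (d - 1)" by simp
  then show ?case using 3 by (cases d) auto
qed

lemma conn_holds_dual_meet:
  "conn_holds v e i s \<Longrightarrow> conn_holds v f i (map dual_conn s) \<Longrightarrow> e \<inter> f \<noteq> {}"
  by (induction v e i s rule: conn_holds.induct) auto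

lemma conn_holds_cong:
  "(\<And>j. i \<le> j \<Longrightarrow> j \<le> i + length s \<Longrightarrow> v j \<in> e \<longleftrightarrow> w j \<in> f) \<Longrightarrow>
    conn_holds v e i s \<longleftrightarrow> conn_holds w f i s"
proof (induction v e i s rule: conn_holds.induct)
  case (2 v e i s)
  then show ?case using "2.prems"[of i] by simp
next
  case (3 v e i s)
  then show ?case using "3.prems"[of i] by simp
qed simp

text \<open>Counts functions whose membership depends on the new coordinate only through its being equal to a
  distinguished value \<open>a\<close>, as is the case for formulas about the \<open>v i\<close>.\<close>

lemma card_PiE_insert:
  assumes "finite I" "i \<notin> I" "\<And>j. j \<in> insert i I \<Longrightarrow> finite (V j)"
    and "card (V i) = Suc q" "a \<in> V i"
    and "\<And>x \<psi>. x \<in> V i \<Longrightarrow> \<psi> \<in> PiE I V \<Longrightarrow> P (\<psi>(i := x)) \<longleftrightarrow> (if x = a then A \<psi> else B \<psi>)"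
  shows "card {\<phi> \<in> PiE (insert i I) V. P \<phi>}
    = card {\<psi> \<in> PiE I V. A \<psi>} + q * card {\<psi> \<in> PiE I V. B \<psi>}"
proof -
  let ?F = "{\<phi> \<in> PiE (insert i I) V. P \<phi>}"
  let ?c = "\<lambda>x. card {\<psi> \<in> PiE I V. \<psi>(i := x) \<in> ?F}"
  have slice: "?c x = card {\<psi> \<in> PiE I V. if x = a then A \<psi> else B \<psi>}" if "x \<in> V i" for x
  proof -
    have "\<psi>(i := x) \<in> PiE (insert i I) V" if "\<psi> \<in> PiE I V" for \<psi>
      using that \<open>x \<in> V i\<close> by (simp add: PiE_fun_upd)
    with assms(6)[OF that] show ?thesis by (intro arg_cong[where f = card] Collect_cong) auto
  qed
  have "card ?F = (\<Sum>x\<in>V i. ?c x)"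
    by (rule card_PiE_slices[OF assms(1-3)]) auto
  also have "\<dots> = (\<Sum>x\<in>V i. card {\<psi> \<in> PiE I V. if x = a then A \<psi> else B \<psi>})"
    using slice by (rule sum.cong[OF refl])
  also have "\<dots> = card {\<psi> \<in> PiE I V. A \<psi>} + (\<Sum>x\<in>V i - {a}. card {\<psi> \<in> PiE I V. B \<psi>})"
    using assms(3,5) by (subst sum.remove[of _ a]) (auto intro!: sum.cong)
  also have "card (V i - {a}) = q" using assms(4,5) by simp
  then have "(\<Sum>x\<in>V i - {a}. card {\<psi> \<in> PiE I V. B \<psi>}) = q * card {\<psi> \<in> PiE I V. B \<psi>}"
    by simp
  finally show ?thesis .
qed

text \<open>The formula is read in the set of coordinates at which \<open>\<phi>\<close> agrees with \<open>v\<close>; in this form it can be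
  evaluated on functions defined on part of the sides, as the induction over \<open>s\<close> requires.\<close>

lemma card_conn_holds:
  assumes "length s < d" and "\<And>j. j \<in> {i..<i + d} \<Longrightarrow> card (V j) = Suc q \<and> v j \<in> V j"
  shows "card {\<phi> \<in> PiE {i..<i + d} V. conn_holds (\<lambda>j. j) {j. \<phi> j = v j} i s}
    = binary_weight q (conn_index d s)"
  using assms
proof (induction s arbitrary: i d)
  case (Nil i d)
  then obtain d' where d: "d = Suc d'" by (cases d) auto
  let ?I = "{Suc i..<Suc i + d'}"
  have sides: "{i..<i + d} = insert i ?I" using d by auto
  note V = Nil.prems(2)[unfolded sides]
  have fin: "finite (V j)" if "j \<in> insert i ?I" for j
    using V[OF that] by (metis card.infinite nat.distinct(1))
  have full: "card {\<psi> \<in> PiE ?I V. True} = binary_weight q (2 ^ d')"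
    using V by (simp add: card_PiE binary_weight_power2)
  have "card {\<phi> \<in> PiE (insert i ?I) V. conn_holds (\<lambda>j. j) {j. \<phi> j = v j} i []}
    = card {\<psi> \<in> PiE ?I V. True} + q * card {\<psi> \<in> PiE ?I V. False}"
    using V by (intro card_PiE_insert[of _ _ _ _ "v i"] fin) auto
  then show ?case unfolding sides full by (simp add: d)
next
  case (Cons c s i d)
  then obtain d' where d: "d = Suc d'" by (cases d) auto
  let ?I = "{Suc i..<Suc i + d'}"
  let ?H = "\<lambda>\<phi> i s. conn_holds (\<lambda>j. j) {j. \<phi> j = v j} i s"
  have sides: "{i..<i + d} = insert i ?I" using d by auto
  note V = Cons.prems(2)[unfolded sides]
  have fin: "finite (V j)" if "j \<in> insert i ?I" for j
    using V[OF that] by (metis card.infinite nat.distinct(1))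
  have full: "card {\<psi> \<in> PiE ?I V. True} = binary_weight q (2 ^ d')"
    using V by (simp add: card_PiE binary_weight_power2)
  have len: "length s < d'" using Cons.prems(1) d by simp
  have IH: "card {\<psi> \<in> PiE ?I V. ?H \<psi> (Suc i) s} = binary_weight q (conn_index d' s)"
    using V by (intro Cons.IH len) auto
  have upd: "?H (\<psi>(i := x)) (Suc i) s \<longleftrightarrow> ?H \<psi> (Suc i) s" for \<psi> x
    by (rule conn_holds_cong) auto
  show ?case
  proof (cases c)
    case Wedge
    have "card {\<phi> \<in> PiE (insert i ?I) V. ?H \<phi> i (Wedge # s)}
      = card {\<psi> \<in> PiE ?I V. ?H \<psi> (Suc i) s} + q * card {\<psi> \<in> PiE ?I V. False}"
      using V upd by (intro card_PiE_insert[of _ _ _ _ "v i"] fin) auto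
    then show ?thesis unfolding sides Wedge IH by (simp add: d)
  next
    case Vee
    have "card {\<phi> \<in> PiE (insert i ?I) V. ?H \<phi> i (Vee # s)}
      = card {\<psi> \<in> PiE ?I V. True} + q * card {\<psi> \<in> PiE ?I V. ?H \<psi> (Suc i) s}"
      using V upd by (intro card_PiE_insert[of _ _ _ _ "v i"] fin) auto
    moreover have "conn_index d' s \<le> 2 ^ d'" using len by (rule conn_index_le)
    ultimately show ?thesis
      unfolding sides Vee IH full
      by (simp add: d binary_weight_power2_add binary_weight_power2)
  qed
qed

section \<open>Edges as functions\<close>

lemma image_Int_image_transversal:
  assumes "disjoint_family_on V I" "\<phi> \<in> PiE I V" "\<psi> \<in> PiE I V"
  shows "\<phi> ` I \<inter> \<psi> ` I \<noteq> {} \<longleftrightarrow> (\<exists>i\<in>I. \<phi> i = \<psi> i)"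
proof
  assume "\<phi> ` I \<inter> \<psi> ` I \<noteq> {}"
  then obtain i j where ij: "i \<in> I" "j \<in> I" "\<phi> i = \<psi> j" by blast
  then have "\<phi> i \<in> V i \<inter> V j" using assms(2,3) by (metis IntI PiE_mem)
  then have "i = j" using assms(1) ij unfolding disjoint_family_on_def by blast
  with ij show "\<exists>i\<in>I. \<phi> i = \<psi> i" by blast
qed blast

lemma vertex_in_image_iff:
  assumes "disjoint_family_on V I" "\<phi> \<in> PiE I V" "i \<in> I" "x \<in> V i"
  shows "x \<in> \<phi> ` I \<longleftrightarrow> \<phi> i = x"
proof
  assume "x \<in> \<phi> ` I"
  then obtain j where j: "j \<in> I" "x = \<phi> j" by blast
  then have "x \<in> V i \<inter> V j" using assms by (metis IntI PiE_mem)
  then have "i = j" using assms(1,3) j unfolding disjoint_family_on_def by blast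
  with j show "\<phi> i = x" by simp
qed (use assms(3) in blast)

text \<open>Edges are the ranges of choice functions. Functions can be restricted to fewer sides and
  extended by a value, which is what the inductions over coordinates need.\<close>

lemma bij_betw_complete_edges:
  assumes "disjoint_family_on V {1..r}"
  shows "bij_betw (\<lambda>\<phi>. \<phi> ` {1..r}) (PiE {1..r} V) (complete_edges r V)"
proof -
  let ?I = "{1..r}"
  have "\<phi> = \<psi>" if "\<phi> \<in> PiE ?I V" "\<psi> \<in> PiE ?I V" "\<phi> ` ?I = \<psi> ` ?I" for \<phi> \<psi>
  proof (rule PiE_ext[OF that(1,2)])
    fix i assume i: "i \<in> ?I"
    then have "\<phi> i \<in> \<psi> ` ?I" using that(3) by blast
    then show "\<phi> i = \<psi> i"
      using vertex_in_image_iff[OF assms that(2) i] PiE_mem[OF that(1) i] by metis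
  qed
  moreover have "\<phi> ` ?I \<in> complete_edges r V" if "\<phi> \<in> PiE ?I V" for \<phi>
  proof -
    have "\<exists>!x. x \<in> \<phi> ` ?I \<and> x \<in> V i" if i: "i \<in> ?I" for i
    proof (rule ex1I[of _ "\<phi> i"])
      show "\<phi> i \<in> \<phi> ` ?I \<and> \<phi> i \<in> V i"
        using i PiE_mem[OF \<open>\<phi> \<in> PiE ?I V\<close> i] by simp
    next
      fix x assume "x \<in> \<phi> ` ?I \<and> x \<in> V i"
      then show "x = \<phi> i"
        using vertex_in_image_iff[OF assms \<open>\<phi> \<in> PiE ?I V\<close> i, of x] by simp
    qed
    moreover have "\<phi> ` ?I \<subseteq> (\<Union>i\<in>?I. V i)"
      using PiE_mem[OF that] by (intro image_subsetI UN_I)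
    ultimately show ?thesis by (simp add: complete_edges_def)
  qed
  moreover have "e \<in> (\<lambda>\<phi>. \<phi> ` ?I) ` PiE ?I V" if "e \<in> complete_edges r V" for e
  proof -
    have ex: "\<exists>!x. x \<in> e \<and> x \<in> V i" if "i \<in> ?I" for i
      using \<open>e \<in> complete_edges r V\<close> that by (simp add: complete_edges_def)
    define \<phi> where "\<phi> = restrict (\<lambda>i. THE x. x \<in> e \<and> x \<in> V i) ?I"
    have \<phi>: "\<phi> i \<in> e \<and> \<phi> i \<in> V i" if "i \<in> ?I" for i
      using theI'[OF ex[OF that]] that by (simp add: \<phi>_def)
    show ?thesis
    proof (rule image_eqI)
      show "\<phi> \<in> PiE ?I V"
        using \<phi> by (intro PiE_I) (blast, simp only: \<phi>_def restrict_apply if_False)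
      show "e = \<phi> ` ?I"
      proof
        show "e \<subseteq> \<phi> ` ?I"
        proof
          fix x assume "x \<in> e"
          moreover obtain i where "i \<in> ?I" "x \<in> V i"
            using \<open>e \<in> complete_edges r V\<close> \<open>x \<in> e\<close> unfolding complete_edges_def by blast
          ultimately show "x \<in> \<phi> ` ?I" using ex[of i] \<phi>[of i] by (intro image_eqI[of _ _ i]) auto
        qed
      qed (use \<phi> in auto)
    qed
  qed
  ultimately show ?thesis
    unfolding bij_betw_def by (intro conjI inj_onI subset_antisym image_subsetI subsetI) simp_all
qed

text \<open>
  The side size is written \<open>q + 1\<close> because \<open>q\<close>, the number of vertices of a side other than the
  marked one, is the base of the weights.
\<close>

locale partite =
  fixes r q :: nat and V :: "nat \<Rightarrow> 'a set" and v :: "nat \<Rightarrow> 'a"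
  assumes r: "r \<ge> 1" and q: "q \<ge> 1"
    and disj: "disjoint_family_on V {1..r}"
    and card_V: "\<And>i. i \<in> {1..r} \<Longrightarrow> card (V i) = Suc q"
    and v: "\<And>i. i \<in> {1..r} \<Longrightarrow> v i \<in> V i"
begin

lemma finite_PiE_sides: "finite (PiE {1..r} V)"
proof (rule finite_PiE)
  show "finite (V i)" if "i \<in> {1..r}" for i
    using card_V[OF that] by (metis card.infinite nat.distinct(1))
qed simp

lemma finite_complete_edges: "finite (complete_edges r V)"
  using bij_betw_finite[OF bij_betw_complete_edges[OF disj]] finite_PiE_sides by simp

lemma card_complete_edges: "card (complete_edges r V) = Suc q ^ r"
  using bij_betw_same_card[OF bij_betw_complete_edges[OF disj]] card_V
  by (simp add: card_PiE)

lemma inj_on_image_sides: "inj_on (\<lambda>\<phi>. \<phi> ` {1..r}) (PiE {1..r} V)"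
  and image_PiE_sides: "(\<lambda>\<phi>. \<phi> ` {1..r}) ` PiE {1..r} V = complete_edges r V"
  using bij_betw_complete_edges[OF disj] by (simp_all add: bij_betw_def)

lemma cross_intersecting_edges_rank_le:
  assumes "F \<subseteq> complete_edges r V" "G \<subseteq> complete_edges r V"
    and "\<And>e f. e \<in> F \<Longrightarrow> f \<in> G \<Longrightarrow> e \<inter> f \<noteq> {}"
  shows "rank q (card F) + rank q (card G) \<le> 2 ^ r"
proof -
  let ?img = "\<lambda>\<phi>. \<phi> ` {1..r}"
  let ?pre = "\<lambda>H. {\<phi> \<in> PiE {1..r} V. ?img \<phi> \<in> H}"
  have card_pre: "card (?pre H) = card H" if "H \<subseteq> complete_edges r V" for H
  proof -
    have "bij_betw ?img (?pre H) H"
    proof (rule bij_betw_subset[OF bij_betw_complete_edges[OF disj]])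
      show "?img ` ?pre H = H"
      proof (intro subset_antisym image_subsetI subsetI)
        fix e assume e: "e \<in> H"
        with that have "e \<in> ?img ` PiE {1..r} V" unfolding image_PiE_sides by (rule subsetD)
        with e show "e \<in> ?img ` ?pre H" by (elim imageE) simp
      qed simp
    qed simp
    then show ?thesis by (rule bij_betw_same_card)
  qed
  have "rank q (card (?pre F)) + rank q (card (?pre G)) \<le> 2 ^ card {1..r}"
  proof (rule cross_intersecting_rank_le[OF q, where V = V])
    fix \<phi> \<psi> assume *: "\<phi> \<in> ?pre F" "\<psi> \<in> ?pre G"
    then have "?img \<phi> \<inter> ?img \<psi> \<noteq> {}" by (intro assms(3)) simp_all
    moreover have "\<phi> \<in> PiE {1..r} V" "\<psi> \<in> PiE {1..r} V" using * by simp_all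
    ultimately show "\<exists>i\<in>{1..r}. \<phi> i = \<psi> i"
      using image_Int_image_transversal[OF disj] by metis
  qed (simp_all add: card_V subset_iff)
  then show ?thesis using card_pre assms by simp
qed

text \<open>Extends the position of formulas to the empty and the full family, which come first and last.\<close>

fun symb_index :: "symb \<Rightarrow> nat" where
  "symb_index Alpha = 0"
| "symb_index Omega = 2 ^ r"
| "symb_index (Conn s) = conn_index r s"

lemma Sigma_r_cases:
  assumes "\<sigma> \<in> Sigma_r r"
  obtains "\<sigma> = Alpha" | "\<sigma> = Omega" | s where "\<sigma> = Conn s" "length s < r"
proof (cases \<sigma>)
  case (Conn s)
  with assms have "s \<in> Psi r" by (auto simp: Sigma_r_def)
  with r Conn that show thesis by (simp add: Psi_def)
qed (use that in simp_all)

lemma Conn_in_Sigma_r: "length s < r \<Longrightarrow> Conn s \<in> Sigma_r r"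
  by (auto simp: Sigma_r_def Psi_def)

lemma dual_symb_in_Sigma: "\<sigma> \<in> Sigma_r r \<Longrightarrow> dual_symb \<sigma> \<in> Sigma_r r"
  by (auto simp: Sigma_r_def Psi_def)

lemma symb_index_dual: "\<sigma> \<in> Sigma_r r \<Longrightarrow> symb_index \<sigma> + symb_index (dual_symb \<sigma>) = 2 ^ r"
  by (erule Sigma_r_cases) (simp_all add: conn_index_dual)

lemma symb_index_image: "symb_index ` Sigma_r r = {..2 ^ r}"
proof
  show "symb_index ` Sigma_r r \<subseteq> {..2 ^ r}"
  proof (rule image_subsetI)
    fix \<sigma> assume "\<sigma> \<in> Sigma_r r"
    then show "symb_index \<sigma> \<in> {..2 ^ r}"
      by (rule Sigma_r_cases) (simp_all add: conn_index_le)
  qed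
  show "{..2 ^ r} \<subseteq> symb_index ` Sigma_r r"
  proof
    fix k assume "k \<in> {..2 ^ r :: nat}"
    then consider "k = 0" | "k = 2 ^ r" | "0 < k" "k < 2 ^ r"
      by (cases "k = 0"; cases "k = 2 ^ r") simp_all
    then show "k \<in> symb_index ` Sigma_r r"
    proof cases
      case 1
      then show ?thesis by (intro image_eqI[of _ _ Alpha]) (simp_all add: Sigma_r_def)
    next
      case 2
      then show ?thesis by (intro image_eqI[of _ _ Omega]) (simp_all add: Sigma_r_def)
    next
      case 3
      then obtain s where "length s < r" "conn_index r s = k"
        using conn_index_surj[of k r] by blast
      then show ?thesis by (intro image_eqI[of _ _ "Conn s"]) (simp_all add: Conn_in_Sigma_r)
    qed
  qed
qed

lemma F_fam_subset: "F_fam r V v \<sigma> \<subseteq> complete_edges r V"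
  by (cases \<sigma>) auto

lemma F_fam_dual_meet:
  "e \<in> F_fam r V v \<sigma> \<Longrightarrow> f \<in> F_fam r V v (dual_symb \<sigma>) \<Longrightarrow> e \<inter> f \<noteq> {}"
  by (cases \<sigma>) (auto dest: conn_holds_dual_meet)

lemma f_card_eq:
  assumes "\<sigma> \<in> Sigma_r r"
  shows "f_card r V v \<sigma> = binary_weight q (symb_index \<sigma>)"
  using assms
proof (cases rule: Sigma_r_cases)
  case (3 s)
  let ?img = "\<lambda>\<phi>. \<phi> ` {1..r}"
  let ?H = "{\<phi> \<in> PiE {1..r} V. conn_holds (\<lambda>j. j) {j. \<phi> j = v j} 1 s}"
  have holds: "conn_holds v (?img \<phi>) 1 s \<longleftrightarrow> conn_holds (\<lambda>j. j) {j. \<phi> j = v j} 1 s"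
    if "\<phi> \<in> PiE {1..r} V" for \<phi>
    using 3(2) vertex_in_image_iff[OF disj that] v by (intro conn_holds_cong) auto
  have "F_fam r V v \<sigma> = ?img ` ?H"
  proof (intro subset_antisym image_subsetI subsetI)
    fix e assume e: "e \<in> F_fam r V v \<sigma>"
    then have "e \<in> ?img ` PiE {1..r} V" unfolding image_PiE_sides by (simp add: 3)
    then obtain \<phi> where "\<phi> \<in> PiE {1..r} V" "e = ?img \<phi>" by (elim imageE)
    with e show "e \<in> ?img ` ?H" using holds[of \<phi>] by (intro image_eqI[of _ _ \<phi>]) (simp_all add: 3)
  next
    fix \<phi> assume "\<phi> \<in> ?H"
    then show "?img \<phi> \<in> F_fam r V v \<sigma>"
      using holds[of \<phi>] image_PiE_sides by (auto simp: 3)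
  qed
  moreover have "inj_on ?img ?H" using inj_on_image_sides by (rule inj_on_subset) simp
  ultimately have "f_card r V v \<sigma> = card ?H" by (simp add: f_card_def card_image)
  moreover have "{1..r} = {1..<1 + r}" by auto
  ultimately show ?thesis
    using card_conn_holds[OF 3(2), of 1 V q v] card_V v 3 by simp
qed (simp_all add: f_card_def card_complete_edges binary_weight_power2)

lemma N_list_eq:
  assumes "k \<le> 2 ^ r"
  shows "N_list r V v k = binary_weight q k"
proof -
  let ?l = "map (binary_weight q) [0..<Suc (2 ^ r)]"
  have "f_card r V v ` Sigma_r r = binary_weight q ` symb_index ` Sigma_r r"
    unfolding image_image by (rule image_cong) (simp_all add: f_card_eq)
  also have "\<dots> = set ?l"
    by (simp only: symb_index_image set_map set_upt atLeast0LessThan lessThan_Suc_atMost)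
  finally have "sorted_list_of_set (f_card r V v ` Sigma_r r) = sorted_list_of_set (set ?l)" by simp
  also have "\<dots> = ?l"
  proof (rule sorted_list_of_set.idem_if_sorted_distinct)
    show "sorted ?l"
      by (simp add: sorted_iff_nth_mono binary_weight_le_iff[OF q] del: upt_Suc)
    show "distinct ?l"
      using strict_mono_imp_inj_on[OF strict_mono_binary_weight[OF q]]
      by (simp only: distinct_map distinct_upt)
  qed
  finally show ?thesis using assms by (simp add: N_list_def del: upt_Suc)
qed

text \<open>By lemma \<open>N_list_eq\<close> the defining property of the index says that it is the least one whose
  weight reaches \<open>t\<close>.\<close>

lemma N_star_eq:
  assumes "t \<le> Suc q ^ r"
  shows "N_star r V v t = rank q t"
proof -
  have le: "rank q t \<le> 2 ^ r"
    using assms by (simp add: rank_le_iff[OF q] binary_weight_power2)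
  show ?thesis unfolding N_star_def
  proof (rule the_equality)
    have "k = 0 \<or> binary_weight q (k - 1) < t" if "k = rank q t" for k
      using rank_le_iff[OF q, of t "k - 1"] that by linarith
    then show "rank q t \<le> 2 ^ r \<and> (rank q t = 0 \<or> N_list r V v (rank q t - 1) < t)
        \<and> t \<le> N_list r V v (rank q t)"
      using le rank_le_iff[OF q, of t "rank q t"] by (simp add: N_list_eq)
  next
    fix k assume k: "k \<le> 2 ^ r \<and> (k = 0 \<or> N_list r V v (k - 1) < t) \<and> t \<le> N_list r V v k"
    then have "rank q t \<le> k" by (auto simp: N_list_eq rank_le_iff[OF q])
    moreover have "k = 0 \<or> \<not> rank q t \<le> k - 1" using k by (auto simp: N_list_eq rank_le_iff[OF q])
    ultimately show "k = rank q t" by linarith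
  qed
qed

text \<open>A family and its blocker cross-intersect, which bounds the blocker. Equality is attained by any
  \<open>t\<close> edges inside the family of the symbol whose index is the rank of \<open>t\<close>, since the family of the
  dual symbol lies in their blocker.\<close>

lemma max_blocker_eq:
  assumes "t \<le> Suc q ^ r"
  shows "max_blocker r V t = binary_weight q (2 ^ r - rank q t)"
proof -
  let ?E = "complete_edges r V"
  let ?B = "{card (blocker r V F) | F. F \<subseteq> ?E \<and> card F = t}"
  have block: "blocker r V F \<subseteq> ?E" for F by (auto simp: blocker_def)
  have upper: "card (blocker r V F) \<le> binary_weight q (2 ^ r - rank q t)"
    if "F \<subseteq> ?E" "card F = t" for F
  proof -
    have "rank q (card F) + rank q (card (blocker r V F)) \<le> 2 ^ r"
      using that(1) block
      by (rule cross_intersecting_edges_rank_le) (auto simp: blocker_def)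
    then show ?thesis using that(2) by (simp add: rank_le_iff[OF q, symmetric])
  qed
  have "rank q t \<le> 2 ^ r"
    using assms by (simp add: rank_le_iff[OF q] binary_weight_power2)
  then have "rank q t \<in> symb_index ` Sigma_r r" by (simp add: symb_index_image)
  then obtain \<sigma> where \<sigma>: "\<sigma> \<in> Sigma_r r" "symb_index \<sigma> = rank q t"
    by (elim imageE) simp
  have "t \<le> card (F_fam r V v \<sigma>)"
    using f_card_eq[OF \<sigma>(1)] \<sigma>(2) rank_le_iff[OF q, of t "rank q t"] by (simp add: f_card_def)
  then obtain F where F: "F \<subseteq> F_fam r V v \<sigma>" "card F = t"
    by (meson obtain_subset_with_card_n)
  have FE: "F \<subseteq> ?E" using F(1) F_fam_subset by blast
  have "F_fam r V v (dual_symb \<sigma>) \<subseteq> blocker r V F"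
    using F(1) F_fam_subset F_fam_dual_meet[of _ \<sigma>] unfolding blocker_def by blast
  then have "card (F_fam r V v (dual_symb \<sigma>)) \<le> card (blocker r V F)"
    by (rule card_mono[OF finite_subset[OF block finite_complete_edges]])
  moreover have "card (F_fam r V v (dual_symb \<sigma>)) = binary_weight q (2 ^ r - rank q t)"
    using f_card_eq[OF dual_symb_in_Sigma[OF \<sigma>(1)]] symb_index_dual[OF \<sigma>(1)] \<sigma>(2)
    by (metis add_diff_cancel_left' f_card_def)
  ultimately have "card (blocker r V F) = binary_weight q (2 ^ r - rank q t)"
    using upper[OF FE F(2)] by simp
  with FE F(2) have "binary_weight q (2 ^ r - rank q t) \<in> ?B"
    by (intro CollectI exI[of _ F]) simp
  moreover have bound: "k \<le> binary_weight q (2 ^ r - rank q t)" if "k \<in> ?B" for k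
    using that upper by (elim CollectE exE) simp
  moreover have "finite ?B"
    by (rule finite_subset[of _ "{..binary_weight q (2 ^ r - rank q t)}"])
      (intro subsetI atMost_iff[THEN iffD2] bound, simp_all)
  ultimately show ?thesis unfolding max_blocker_def by (intro Max_eqI)
qed

end

theorem theorem1p14:
  fixes r n t :: nat and V :: "nat \<Rightarrow> 'a set" and v :: "nat \<Rightarrow> 'a"
  assumes "r \<ge> 1" and "n \<ge> 2"
    and "disjoint_family_on V {1..r}"
    and "\<forall>i\<in>{1..r}. card (V i) = n"
    and "\<forall>i\<in>{1..r}. v i \<in> V i"
    and "t \<le> n ^ r"
  shows "max_blocker r V t = N_list r V v (2 ^ r - N_star r V v t)"
proof -
  have n: "n = Suc (n - 1)" using assms(2) by simp
  interpret partite r "n - 1" V v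
    using assms(1-5) by unfold_locales auto
  have t: "t \<le> Suc (n - 1) ^ r" using assms(6) n by simp
  show ?thesis using max_blocker_eq[OF t] by (simp add: N_star_eq[OF t] N_list_eq)
qed

end
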